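(* Let $p\in(0,1)$ be a constant not depending on $n$, and for each $n$ let $G_n$ be a random graph drawn from the Erdős–Rényi model $\mathcal{G}(n,p)$. Then there exists a function $\varepsilon(n)\ge 0$ with $\varepsilon(n)\to 0$ as $n\to\infty$ such that $$\mathbb{P}\Big( n^{1-\varepsilon(n)} \le HG(G_n) \le (1-\varepsilon(n))\,n \Big)\longrightarrow 1 \quad\text{as } n\to\infty,$$ i.e. with high probability $n^{1-o(1)}\le HG(G_n)\le (1-o(1))n$.
   Context: $\mathcal{G}(n,p)$ denotes the Erdős–Rényi random graph on vertex set $\{1,\dots,n\}$ in which each of the $\binom{n}{2}$ possible edges is included independently with probability $p$. Hat guessing number: let $G=(V,E)$ be a finite graph and $q$ a positive integer. A hat assignment is a function $c:V\to\{1,\dots,q\}$. A guessing strategy consists of, for each vertex $v\in V$, a function $f_v$ that maps each coloring $c|_{N(v)}:N(v)\to\{1,\dots,q\}$ of the neighborhood $N(v)$ of $v$ to a guess $f_v(c|_{N(v)})\in\{1,\dots,q\}$ (so the guess of $v$ depends only on the colors of its neighbors). The strategy is winning if for every hat assignment $c:V\to\{1,\dots,q\}$ there is at least one vertex $v$ with $f_v(c|_{N(v)})=c(v)$. The hat guessing number $HG(G)$ is the largest integer $q$ for which a winning guessing strategy with $q$ colors exists. *)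

theory Defs
  imports "HOL-Probability.Probability"
begin

text \<open>
  A finite simple graph is given by its vertex set \<open>V\<close> and its edge set \<open>E\<close>,
  whose members are two-element subsets of \<open>V\<close>.
\<close>

definition all_edges :: "'v set \<Rightarrow> 'v set set" where
  "all_edges V = {e. e \<subseteq> V \<and> card e = 2}"

definition nbhd :: "'v set \<Rightarrow> 'v set set \<Rightarrow> 'v \<Rightarrow> 'v set" where
  "nbhd V E v = {u \<in> V. {u, v} \<in> E}"

definition hat_assignments :: "'v set \<Rightarrow> nat \<Rightarrow> ('v \<Rightarrow> nat) set" where
  "hat_assignments S q = S \<rightarrow>\<^sub>E {1..q}"

definition guessing_strategy ::
    "'v set \<Rightarrow> 'v set set \<Rightarrow> nat \<Rightarrow> ('v \<Rightarrow> ('v \<Rightarrow> nat) \<Rightarrow> nat) \<Rightarrow> bool" where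
  "guessing_strategy V E q f \<longleftrightarrow>
     (\<forall>v\<in>V. f v \<in> hat_assignments (nbhd V E v) q \<rightarrow> {1..q})"

definition winning_strategy ::
    "'v set \<Rightarrow> 'v set set \<Rightarrow> nat \<Rightarrow> ('v \<Rightarrow> ('v \<Rightarrow> nat) \<Rightarrow> nat) \<Rightarrow> bool" where
  "winning_strategy V E q f \<longleftrightarrow>
     guessing_strategy V E q f \<and>
     (\<forall>c \<in> hat_assignments V q. \<exists>v\<in>V. f v (restrict c (nbhd V E v)) = c v)"

text \<open>
  For finite nonempty \<open>V\<close> the value \<open>q = 1\<close> always qualifies and every qualifying \<open>q\<close> is at
  most \<open>card V\<close>, so the maximum exists; it is unspecified for \<open>V = {}\<close>.
\<close>

definition HG :: "'v set \<Rightarrow> 'v set set \<Rightarrow> nat" where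
  "HG V E = (GREATEST q. 0 < q \<and> (\<exists>f. winning_strategy V E q f))"

text \<open>The law of the edge set of the Erdos--Renyi random graph on \<open>{1..n}\<close>.\<close>

definition gnp :: "nat \<Rightarrow> real \<Rightarrow> nat set set pmf" where
  "gnp n p =
     map_pmf (\<lambda>\<omega>. {e \<in> all_edges {1..n}. \<omega> e})
       (Pi_pmf (all_edges {1..n}) False (\<lambda>_. bernoulli_pmf p))"

end

theory Submission
  imports Defs "HOL-Real_Asymp.Real_Asymp"
begin

text \<open>
  Upper bound. Under a uniformly random hat assignment, the event that \<open>v\<close> guesses correctly has
  probability \<open>1/q\<close> and is independent of all the corresponding events of the non-neighbours of \<open>v\<close>.
  Split the vertices into \<open>S\<close> and its complement. The event that some vertex of \<open>S\<close> is correct is either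
  much less likely than the union bound \<open>|S|/q\<close> predicts, or it makes many non-neighbours outside \<open>S\<close>
  redundant. Since every vertex of the random graph has linearly many non-neighbours, either way
  \<open>q \<le> (1 - c) n\<close> for a constant \<open>c > 0\<close>.

  Lower bound. Take a clique \<open>U\<close> of size \<open>d\<close> about \<open>2 ln n / ln ln n\<close> and the set \<open>W\<close> of its common
  neighbours, which has about \<open>p^d n = n^(1 - o(1))\<close> elements. If the vertices of \<open>W\<close> use random functions of
  the colours on \<open>U\<close>, then whatever the colours on \<open>W\<close> are, fewer than \<open>d^d\<close> colourings of \<open>U\<close> survive, that
  is, make every vertex of \<open>W\<close> guess wrongly. The clique can cover any \<open>d^d\<close> colourings: this is a matching of
  points of a grid into the axis-parallel lines through them, and Hall's condition follows from the entropy
  form of the Loomis--Whitney inequality.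

  Here the lower bound holds with \<open>\<epsilon>(n) = 1 / sqrt (ln ln n)\<close>, and as the upper bound gains a
  constant factor, the same \<open>\<epsilon>\<close> serves for both.
\<close>

section \<open>Colourings covered by a clique\<close>

text \<open>Either some nonempty proper subfamily is tight; it is matched on its own, and the rest
  keeps Hall's condition after the tight neighbourhood is removed. Or every such subfamily has an
  element to spare, so that a single index may take any element of its set.\<close>

lemma hall_marriage:
  fixes A :: "'i \<Rightarrow> 'a set"
  assumes "finite I" and "\<And>i. i \<in> I \<Longrightarrow> finite (A i)"
    and "\<And>J. J \<subseteq> I \<Longrightarrow> card J \<le> card (\<Union>(A ` J))"
  shows "\<exists>r. inj_on r I \<and> (\<forall>i\<in>I. r i \<in> A i)"
  using assms
proof (induction "card I" arbitrary: I A rule: less_induct)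
  case less
  show ?case
  proof (cases "\<exists>J. J \<subset> I \<and> J \<noteq> {} \<and> card J = card (\<Union>(A ` J))")
    case True
    then obtain J where J: "J \<subset> I" "J \<noteq> {}" "card J = card (\<Union>(A ` J))" by blast
    have fJ: "finite J" using J less.prems(1) by (meson finite_subset psubset_imp_subset)
    define N where "N = \<Union>(A ` J)"
    have fN: "finite N" unfolding N_def using fJ J less.prems(2) by auto
    have "\<exists>r. inj_on r J \<and> (\<forall>i\<in>J. r i \<in> A i)"
    proof (rule less.hyps)
      show "card J < card I" by (rule psubset_card_mono[OF less.prems(1) J(1)])
    qed (use J less.prems fJ in auto)
    then obtain r1 where r1: "inj_on r1 J" "\<forall>i\<in>J. r1 i \<in> A i" by blast
    have "\<exists>r. inj_on r (I - J) \<and> (\<forall>i\<in>I - J. r i \<in> A i - N)"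
    proof (rule less.hyps)
      show "card (I - J) < card I" using J less.prems(1)
        by (metis card_Diff_subset card_gt_0_iff diff_less fJ psubset_imp_subset psubset_card_mono gr_implies_not0 neq0_conv)
      show "card K \<le> card (\<Union>i\<in>K. A i - N)" if K: "K \<subseteq> I - J" for K
      proof -
        have fK: "finite K" using K less.prems(1) by (meson finite_Diff finite_subset)
        have fU: "finite (\<Union>i\<in>K. A i - N)" using fK K less.prems(2) by auto
        have "card K + card J = card (K \<union> J)"
          using K fK fJ by (subst card_Un_disjoint) auto
        also have "\<dots> \<le> card (\<Union>(A ` (K \<union> J)))" using K J by (intro less.prems) auto
        also have "\<Union>(A ` (K \<union> J)) = (\<Union>i\<in>K. A i - N) \<union> N" unfolding N_def by auto
        also have "card \<dots> = card (\<Union>i\<in>K. A i - N) + card N"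
          using fU fN by (intro card_Un_disjoint) auto
        finally show ?thesis using J(3) N_def by simp
      qed
    qed (use less.prems in auto)
    then obtain r2 where r2: "inj_on r2 (I - J)" "\<forall>i\<in>I - J. r2 i \<in> A i - N" by blast
    have m: "r1 i \<in> N" if "i \<in> J" for i using r1 that N_def by auto
    let ?r = "\<lambda>i. if i \<in> J then r1 i else r2 i"
    have "inj_on ?r I"
      using r1(1) r2 m unfolding inj_on_def by (metis DiffD2 DiffI)
    moreover have "\<forall>i\<in>I. ?r i \<in> A i" using r1 r2 by auto
    ultimately show ?thesis by blast
  next
    case False
    show ?thesis
    proof (cases "I = {}")
      case True then show ?thesis by auto
    next
      case ne: False
      then obtain i where i: "i \<in> I" by auto
      have "card {i} \<le> card (\<Union>(A ` {i}))" using i by (intro less.prems) auto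
      then obtain a where a: "a \<in> A i" by fastforce
      have "\<exists>r. inj_on r (I - {i}) \<and> (\<forall>j\<in>I - {i}. r j \<in> A j - {a})"
      proof (rule less.hyps)
        show "card (I - {i}) < card I" using i less.prems(1) by (intro card_Diff1_less)
        show "card K \<le> card (\<Union>j\<in>K. A j - {a})" if K: "K \<subseteq> I - {i}" for K
        proof (cases "K = {}")
          case nK: False
          have le: "card K \<le> card (\<Union>(A ` K))" using K by (intro less.prems) auto
          have "K \<subset> I" using K i by auto
          then have "card K \<noteq> card (\<Union>(A ` K))" using False nK by blast
          moreover have "(\<Union>j\<in>K. A j - {a}) = \<Union>(A ` K) - {a}" by auto
          moreover have "card (\<Union>(A ` K)) - 1 \<le> card (\<Union>(A ` K) - {a})"
            using diff_card_le_card_Diff[of "{a}" "\<Union>(A ` K)"] by simp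
          ultimately show ?thesis using le by simp
        qed simp
      qed (use less.prems in auto)
      then obtain r where r: "inj_on r (I - {i})" "\<forall>j\<in>I - {i}. r j \<in> A j - {a}" by blast
      have "inj_on (r(i := a)) I"
        using r unfolding inj_on_def by (metis DiffD2 DiffI fun_upd_apply insertI1 singletonD)
      moreover have "\<forall>j\<in>I. (r(i := a)) j \<in> A j" using r a by auto
      ultimately show ?thesis by blast
    qed
  qed
qed

text \<open>Han's inequality \<open>\<Sum>\<^sub>i H(X\<^sub>i | X\<^sub>j, j \<noteq> i) \<le> H(X)\<close> for \<open>X\<close> uniform on \<open>S\<close>.\<close>

lemma sum_ln_line_card_le:
  fixes S :: "('v \<Rightarrow> 'a) set"
  assumes "finite D" "finite S" "\<And>x y j. x \<in> S \<Longrightarrow> y \<in> S \<Longrightarrow> j \<notin> D \<Longrightarrow> x j = y j"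
  shows "(\<Sum>x\<in>S. \<Sum>i\<in>D. ln (real (card {y\<in>S. \<forall>j. j \<noteq> i \<longrightarrow> y j = x j})))
           \<le> real (card S) * ln (real (card S))"
  using assms
proof (induction D arbitrary: S rule: finite_induct)
  case empty
  show ?case by (cases "card S = 0") auto
next
  case (insert i D)
  note fin = \<open>finite S\<close>
  define l where "l = (\<lambda>S j x. card {y\<in>S. \<forall>k. k \<noteq> j \<longrightarrow> y k = (x :: 'v \<Rightarrow> 'a) k})"
  \<comment> \<open>The induction hypothesis is applied to the slices of \<open>S\<close> on which
    coordinate \<open>i\<close> is constant; lines in the other directions stay inside one
    slice.\<close>
  define P where "P = (\<lambda>k. {x\<in>S. x i = k})"
  have fP: "finite (P k)" for k using fin by (simp add: P_def)
  have lP: "l (P (x i)) j x = l S j x" if "j \<in> D" "x \<in> S" for j x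
  proof -
    have "j \<noteq> i" using that insert.hyps by auto
    then show ?thesis unfolding l_def P_def by (intro arg_cong[of _ _ card]) auto
  qed
  have pos: "0 < l S i x" "0 < card (P (x i))" if "x \<in> S" for x
    using that fin fP unfolding l_def P_def by (auto simp: card_gt_0_iff)
  have grp: "(\<Sum>x\<in>S. g x) = (\<Sum>k\<in>(\<lambda>x. x i) ` S. \<Sum>x\<in>P k. g x)" for g :: "('v \<Rightarrow> 'a) \<Rightarrow> real"
    using sum.image_gen[OF fin, of g "\<lambda>x. x i"] by (simp add: P_def)
  have "(\<Sum>x\<in>S. \<Sum>j\<in>D. ln (real (l S j x))) = (\<Sum>k\<in>(\<lambda>x. x i) ` S. \<Sum>x\<in>P k. \<Sum>j\<in>D. ln (real (l (P k) j x)))"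
    unfolding grp by (intro sum.cong refl) (auto simp: P_def simp flip: lP)
  also have "\<dots> \<le> (\<Sum>k\<in>(\<lambda>x. x i) ` S. real (card (P k)) * ln (real (card (P k))))"
  proof (intro sum_mono)
    fix k
    show "(\<Sum>x\<in>P k. \<Sum>j\<in>D. ln (real (l (P k) j x))) \<le> real (card (P k)) * ln (real (card (P k)))"
      unfolding l_def
    proof (rule insert.IH[OF fP])
      show "x j = y j" if "x \<in> P k" "y \<in> P k" "j \<notin> D" for x y j
        using insert.prems(2)[of x y j] that by (cases "j = i") (auto simp: P_def)
    qed
  qed
  also have "\<dots> = (\<Sum>k\<in>(\<lambda>x. x i) ` S. \<Sum>x\<in>P k. ln (real (card (P (x i)))))"
    by (intro sum.cong refl) (simp add: P_def)
  also have "\<dots> = (\<Sum>x\<in>S. ln (real (card (P (x i)))))"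
    by (rule grp[symmetric])
  finally have IH: "(\<Sum>x\<in>S. \<Sum>j\<in>D. ln (real (l S j x))) \<le> (\<Sum>x\<in>S. ln (real (card (P (x i)))))" .
  \<comment> \<open>A triple \<open>(x, y, z)\<close> with \<open>y\<close> on the \<open>i\<close>-line of \<open>x\<close> and \<open>z i = x i\<close> is determined by \<open>(y, z)\<close>.\<close>
  have "(\<Sum>x\<in>S. l S i x * card (P (x i)))
      = card (SIGMA x:S. {y\<in>S. \<forall>k. k \<noteq> i \<longrightarrow> y k = x k} \<times> P (x i))"
    using fin fP by (simp add: l_def card_cartesian_product)
  also have "\<dots> \<le> card (S \<times> S)"
  proof (rule card_inj_on_le[where f = snd])
    show "inj_on snd (SIGMA x:S. {y\<in>S. \<forall>k. k \<noteq> i \<longrightarrow> y k = x k} \<times> P (x i))"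
    proof (rule inj_onI)
      fix a b
      assume a: "a \<in> (SIGMA x:S. {y\<in>S. \<forall>k. k \<noteq> i \<longrightarrow> y k = x k} \<times> P (x i))"
        and b: "b \<in> (SIGMA x:S. {y\<in>S. \<forall>k. k \<noteq> i \<longrightarrow> y k = x k} \<times> P (x i))"
        and ab: "snd a = snd b"
      obtain x y z where x: "a = (x, y, z)" by (cases a)
      obtain x' where x': "b = (x', y, z)" using ab x by (cases b) simp
      have "x k = x' k" for k
      proof (cases "k = i")
        case True
        have "z i = x i" "z i = x' i" using a b x x' by (simp_all add: P_def)
        then show ?thesis using True by simp
      next
        case False
        have "y k = x k" "y k = x' k" using a b x x' False by simp_all
        then show ?thesis by simp
      qed
      then show "a = b" using x x' by (simp add: fun_eq_iff)
    qed
    show "snd ` (SIGMA x:S. {y\<in>S. \<forall>k. k \<noteq> i \<longrightarrow> y k = x k} \<times> P (x i)) \<subseteq> S \<times> S"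
    proof -
      have "snd ` (SIGMA x:S. N x \<times> P (x i)) \<subseteq> S \<times> S"
        if "\<And>x. N x \<subseteq> S" "\<And>k. P k \<subseteq> S" for N :: "('v \<Rightarrow> 'a) \<Rightarrow> ('v \<Rightarrow> 'a) set" and P
        using that by fastforce
      from this[of "\<lambda>x. {y\<in>S. \<forall>k. k \<noteq> i \<longrightarrow> y k = x k}" P] show ?thesis
        by (simp add: P_def Collect_subset)
    qed
  qed (use fin in simp)
  finally have sq: "(\<Sum>x\<in>S. l S i x * card (P (x i))) \<le> card S * card S"
    by (simp add: card_cartesian_product)
  have "(\<Sum>x\<in>S. \<Sum>j\<in>insert i D. ln (real (l S j x)))
      = (\<Sum>x\<in>S. ln (real (l S i x))) + (\<Sum>x\<in>S. \<Sum>j\<in>D. ln (real (l S j x)))"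
    using insert.hyps by (simp add: sum.distrib)
  also have "\<dots> \<le> (\<Sum>x\<in>S. ln (real (l S i x)) + ln (real (card (P (x i)))))"
    using IH by (simp add: sum.distrib)
  \<comment> \<open>This is \<open>ln t \<le> t - 1\<close> with
    \<open>t = l S i x * card (P (x i)) / card S\<close>. By \<open>sq\<close> these
    \<open>t\<close> sum to at most \<open>card S\<close>, so the correction terms add up to at most
    0.\<close>
  also have "\<dots> \<le> (\<Sum>x\<in>S. ln (real (card S)) + (real (l S i x * card (P (x i))) / real (card S) - 1))"
  proof (intro sum_mono)
    fix x assume x: "x \<in> S"
    have c: "0 < card S" using x fin by (auto simp: card_gt_0_iff)
    have "ln (real (l S i x)) + ln (real (card (P (x i)))) - ln (real (card S))
        = ln (real (l S i x * card (P (x i))) / real (card S))"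
      using pos[OF x] c by (simp add: ln_mult ln_div)
    also have "\<dots> \<le> real (l S i x * card (P (x i))) / real (card S) - 1"
      using pos[OF x] c by (intro ln_le_minus_one) simp
    finally show "ln (real (l S i x)) + ln (real (card (P (x i))))
        \<le> ln (real (card S)) + (real (l S i x * card (P (x i))) / real (card S) - 1)" by simp
  qed
  also have "\<dots> = real (card S) * ln (real (card S))
      + (real (\<Sum>x\<in>S. l S i x * card (P (x i))) / real (card S) - real (card S))"
    by (simp add: sum.distrib sum_subtractf sum_divide_distrib)
  also have "\<dots> \<le> real (card S) * ln (real (card S))"
  proof -
    define m where "m = (\<Sum>x\<in>S. l S i x * card (P (x i)))"
    have "real m \<le> real (card S) * real (card S)"
      using of_nat_mono[OF sq, where 'a = real] by (simp only: m_def of_nat_mult)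
    then show ?thesis unfolding m_def[symmetric]
      by (cases "card S = 0") (auto simp: field_simps)
  qed
  finally show ?case unfolding l_def .
qed

text \<open>Each fibre of \<open>f\<close> in \<open>J\<close> contributes a total of 1.\<close>

lemma card_image_eq_sum_inverse:
  assumes "finite J"
  shows "real (card (f ` J)) = (\<Sum>x\<in>J. 1 / real (card {y\<in>J. f y = f x}))"
proof -
  have "(\<Sum>x\<in>J. 1 / real (card {y\<in>J. f y = f x}))
      = (\<Sum>k\<in>f ` J. \<Sum>x\<in>{x\<in>J. f x = k}. 1 / real (card {y\<in>J. f y = f x}))"
    by (rule sum.image_gen[OF assms])
  also have "\<dots> = (\<Sum>k\<in>f ` J. 1)"
  proof (intro sum.cong refl)
    fix k assume "k \<in> f ` J"
    then have "card {x\<in>J. f x = k} \<noteq> 0" using assms by auto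
    then show "(\<Sum>x\<in>{x\<in>J. f x = k}. 1 / real (card {y\<in>J. f y = f x})) = 1" by simp
  qed
  finally show ?thesis by simp
qed

text \<open>By the entropy inequality the mean of the logarithm of the line length, over all
  \<open>x\<close> and \<open>u\<close>, is at most \<open>ln (card J) / card U\<close>, hence at
  most \<open>ln (card U)\<close> by the size assumption. By convexity the mean reciprocal line
  length is at least \<open>1 / card U\<close>, and the reciprocals sum to the number of
  projections.\<close>

lemma card_le_sum_card_projections:
  assumes "finite U" "U \<noteq> {}" "J \<subseteq> U \<rightarrow>\<^sub>E B" "finite J" "card J \<le> card U ^ card U"
  shows "card J \<le> (\<Sum>u\<in>U. card ((\<lambda>x. restrict x (U - {u})) ` J))"
proof (cases "J = {}")
  case True
  then show ?thesis using assms by auto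
next
  case False
  define d where "d = real (card U)"
  have d: "d > 0" using assms(1,2) by (simp add: d_def card_gt_0_iff)
  have cJ: "card J > 0" using False assms by (simp add: card_gt_0_iff)
  define l where "l = (\<lambda>u x. real (card {y\<in>J. \<forall>j. j \<noteq> u \<longrightarrow> y j = x j}))"
  have eq: "restrict y (U - {u}) = restrict x (U - {u}) \<longleftrightarrow> (\<forall>j. j \<noteq> u \<longrightarrow> y j = x j)"
    if "x \<in> J" "y \<in> J" for x y u
  proof -
    have "x j = y j" if "j \<notin> U" for j
      using assms(3) \<open>x \<in> J\<close> \<open>y \<in> J\<close> that by (metis PiE_arb subsetD)
    then show ?thesis by (auto simp: restrict_def fun_eq_iff) metis
  qed
  have lpos: "l u x > 0" if "x \<in> J" for u x
    using that assms(4) unfolding l_def by (auto simp: card_gt_0_iff)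
  have ent: "(\<Sum>x\<in>J. \<Sum>u\<in>U. ln (l u x)) \<le> real (card J) * ln (real (card J))"
    unfolding l_def
  proof (rule sum_ln_line_card_le)
    show "x j = y j" if "x \<in> J" "y \<in> J" "j \<notin> U" for x y j
      using assms(3) that by (metis PiE_arb subsetD)
  qed (use assms in auto)
  have "real (card J) \<le> d ^ card U"
    using assms(5) unfolding d_def by (metis of_nat_le_iff of_nat_power)
  then have "ln (real (card J)) \<le> ln (d ^ card U)"
    using cJ d by (subst ln_le_cancel_iff) auto
  then have lnJ: "ln (real (card J)) \<le> d * ln d" using d by (simp add: ln_realpow d_def)
  have "real (card J) * d = (\<Sum>x\<in>J. \<Sum>u\<in>U. 1)" by (simp add: d_def)
  \<comment> \<open>The tangent bound \<open>ln t \<le> t - 1\<close> at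
    \<open>t = d / l u x\<close> takes the place of Jensen's inequality.\<close>
  also have "\<dots> \<le> (\<Sum>x\<in>J. \<Sum>u\<in>U. d * (1 / l u x) + ln (l u x) - ln d)"
  proof (intro sum_mono)
    fix x u assume x: "x \<in> J"
    have "ln (d / l u x) \<le> d / l u x - 1" using lpos[OF x] d by (intro ln_le_minus_one) simp
    then show "1 \<le> d * (1 / l u x) + ln (l u x) - ln d" using lpos[OF x, of u] d by (simp add: ln_div)
  qed
  also have "\<dots> = d * (\<Sum>x\<in>J. \<Sum>u\<in>U. 1 / l u x) + (\<Sum>x\<in>J. \<Sum>u\<in>U. ln (l u x)) - real (card J) * (d * ln d)"
    by (simp add: sum.distrib sum_subtractf sum_distrib_left d_def)
  also have "\<dots> \<le> d * (\<Sum>x\<in>J. \<Sum>u\<in>U. 1 / l u x) + real (card J) * (d * ln d) - real (card J) * (d * ln d)"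
    using ent lnJ by (smt (verit) mult_left_mono of_nat_0_le_iff)
  finally have "real (card J) \<le> (\<Sum>x\<in>J. \<Sum>u\<in>U. 1 / l u x)" using d by (simp add: mult.commute)
  also have "\<dots> = (\<Sum>u\<in>U. \<Sum>x\<in>J. 1 / l u x)" by (rule sum.swap)
  also have "\<dots> = (\<Sum>u\<in>U. real (card ((\<lambda>x. restrict x (U - {u})) ` J)))"
  proof (intro sum.cong refl)
    fix u
    have "{y\<in>J. \<forall>j. j \<noteq> u \<longrightarrow> y j = x j} = {y\<in>J. restrict y (U - {u}) = restrict x (U - {u})}"
      if "x \<in> J" for x using eq[OF that] by auto
    then show "(\<Sum>x\<in>J. 1 / l u x) = real (card ((\<lambda>x. restrict x (U - {u})) ` J))"
      unfolding card_image_eq_sum_inverse[OF assms(4)] l_def by simp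
  qed
  finally show ?thesis by (simp flip: of_nat_sum)
qed

text \<open>A vertex \<open>u\<close> that sees \<open>y\<close> can be made right for one colouring
  on the line \<open>(u, y)\<close>. Hall's theorem assigns to each colouring in \<open>S\<close> a
  line of its own; \<open>card_le_sum_card_projections\<close> is Hall's condition.\<close>

lemma clique_covers_few_colorings:
  fixes U :: "'a set" and B :: "'b set"
  assumes "finite U" "U \<noteq> {}" "S \<subseteq> U \<rightarrow>\<^sub>E B" "finite S" "card S \<le> card U ^ card U"
  shows "\<exists>h. \<forall>x\<in>S. \<exists>u\<in>U. h u (restrict x (U - {u})) = x u"
proof -
  define A where "A = (\<lambda>x :: 'a \<Rightarrow> 'b. (\<lambda>u. (u, restrict x (U - {u}))) ` U)"
  have "\<exists>r. inj_on r S \<and> (\<forall>x\<in>S. r x \<in> A x)"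
  proof (rule hall_marriage)
    show "card J \<le> card (\<Union>(A ` J))" if J: "J \<subseteq> S" for J
    proof -
      have fJ: "finite J" using J assms(4) finite_subset by blast
      have "card J \<le> (\<Sum>u\<in>U. card ((\<lambda>x. restrict x (U - {u})) ` J))"
      proof (rule card_le_sum_card_projections[where B = B])
        show "card J \<le> card U ^ card U" using card_mono[OF assms(4) J] assms(5) by simp
      qed (use assms J fJ in auto)
      also have "\<dots> = card (SIGMA u:U. (\<lambda>x. restrict x (U - {u})) ` J)"
        using assms(1) fJ by simp
      also have "(SIGMA u:U. (\<lambda>x. restrict x (U - {u})) ` J) = \<Union>(A ` J)"
        unfolding A_def by auto
      finally show ?thesis .
    qed
  qed (use assms in \<open>auto simp: A_def\<close>)
  then obtain r where r: "inj_on r S" "\<And>x. x \<in> S \<Longrightarrow> r x \<in> A x" by blast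
  \<comment> \<open>On a line matched with no colouring, \<open>h\<close> is arbitrary and need not
    take values in \<open>B\<close>.\<close>
  define h where "h = (\<lambda>u y. the_inv_into S r (u, y) u)"
  have "\<exists>u\<in>U. h u (restrict x (U - {u})) = x u" if x: "x \<in> S" for x
  proof -
    obtain u where u: "u \<in> U" "r x = (u, restrict x (U - {u}))" using r(2)[OF x] by (auto simp: A_def)
    have "h u (restrict x (U - {u})) = x u"
      unfolding h_def u(2)[symmetric] using the_inv_into_f_f[OF r(1) x] by simp
    then show ?thesis using u by blast
  qed
  then show ?thesis by blast
qed

section \<open>Upper bound for winning strategies\<close>

text \<open>Recolouring \<open>v\<close> splits \<open>B\<close> into classes of \<open>q\<close>
  assignments. The guess is constant on a class, so exactly one assignment in each class is guessed
  correctly.\<close>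

lemma card_correct_guess:
  assumes B: "B \<subseteq> V \<rightarrow>\<^sub>E {1..q}" "v \<in> V"
    and inv: "\<And>c x. c \<in> B \<Longrightarrow> x \<in> {1..q} \<Longrightarrow> c(v := x) \<in> B"
    and g: "\<And>c. c \<in> B \<Longrightarrow> g c \<in> {1..q}" "\<And>c x. g (c(v := x)) = g c"
  shows "q * card {c \<in> B. g c = c v} = card B"
proof -
  have "bij_betw (\<lambda>(c, x). c(v := x)) ({c \<in> B. g c = c v} \<times> {1..q}) B"
  proof (rule bij_betw_byWitness[where f' = "\<lambda>c. (c(v := g c), c v)"])
    show "\<forall>a\<in>{c \<in> B. g c = c v} \<times> {1..q}.
        (\<lambda>c. (c(v := g c), c v)) (case a of (c, x) \<Rightarrow> c(v := x)) = a"
      using g by auto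
    show "(\<lambda>c. (c(v := g c), c v)) ` B \<subseteq> {c \<in> B. g c = c v} \<times> {1..q}"
      using g inv B by (auto 0 3 dest: subsetD PiE_mem)
  qed (use inv in auto)
  then have "card ({c \<in> B. g c = c v} \<times> {1..q}) = card B" by (rule bij_betw_same_card)
  then show ?thesis by (simp add: card_cartesian_product mult.commute)
qed

text \<open>A vertex \<open>i\<close> outside \<open>S\<close> is charged only for assignments
  outside \<open>USN i\<close>, where no non-neighbour of \<open>i\<close> in \<open>S\<close> is
  right. Each element of \<open>US\<close> saves at least \<open>D\<close> such charges, so
  \<open>US\<close> enters with weight \<open>q - D\<close>, and \<open>card US\<close> is at most
  \<open>card S * card \<Omega> / q\<close> by the union bound.\<close>

lemma winning_strategy_bound:
  assumes V: "finite V" "E \<subseteq> all_edges V" "S \<subseteq> V" and win: "winning_strategy V E q f"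
    and D: "\<And>s. s \<in> S \<Longrightarrow> D \<le> card {i \<in> V - S. {s, i} \<notin> E}" and Dq: "D \<le> q"
  shows "q * q + D * card S \<le> q * card V"
proof -
  define \<Omega> where "\<Omega> = V \<rightarrow>\<^sub>E {1..q}"
  define g where "g = (\<lambda>v c. f v (restrict c (nbhd V E v)))"
  define A where "A = (\<lambda>v. {c \<in> \<Omega>. g v c = c v})"
  define US where "US = (\<Union>s\<in>S. A s)"
  define USN where "USN = (\<lambda>i. \<Union>s\<in>{s\<in>S. {s, i} \<notin> E}. A s)"
  have fin: "finite \<Omega>" using V by (simp add: \<Omega>_def finite_PiE)
  have fA: "finite (A v)" for v using fin by (simp add: A_def)
  have fS: "finite S" using V finite_subset by blast
  have fUS: "finite US" using fA fS by (simp add: US_def)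
  have Un_sub: "USN i \<subseteq> US" "USN i \<subseteq> \<Omega>" for i by (auto simp: US_def USN_def A_def)
  have fUN: "finite (USN i)" for i by (rule finite_subset[OF Un_sub(2) fin])
  have g_mem: "g v c \<in> {1..q}" if "v \<in> V" "c \<in> \<Omega>" for v c
  proof -
    have "restrict c (nbhd V E v) \<in> hat_assignments (nbhd V E v) q"
      using that by (auto simp: hat_assignments_def nbhd_def \<Omega>_def)
    moreover have "f v \<in> hat_assignments (nbhd V E v) q \<rightarrow> {1..q}"
      using win that(1) unfolding winning_strategy_def guessing_strategy_def by blast
    ultimately show ?thesis unfolding g_def by (rule funcset_mem[rotated])
  qed
  have g_upd: "g v (c(i := x)) = g v c" if "{v, i} \<notin> E" for v i c x
  proof -
    have "restrict (c(i := x)) (nbhd V E v) = restrict c (nbhd V E v)"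
      using that by (auto simp: nbhd_def fun_eq_iff insert_commute)
    then show ?thesis by (simp add: g_def)
  qed
  have noloop: "{v, v} \<notin> E" for v using V by (auto simp: all_edges_def)
  have upd: "c(v := x) \<in> \<Omega>" if "c \<in> \<Omega>" "v \<in> V" "x \<in> {1..q}" for c v x
    using that by (auto simp: \<Omega>_def PiE_def extensional_def)
  have cardA: "q * card (A v) = card \<Omega>" if "v \<in> V" for v
    unfolding A_def
    by (rule card_correct_guess[of \<Omega> V])
      (use that upd g_mem g_upd[OF noloop] in \<open>auto simp: \<Omega>_def\<close>)
  \<comment> \<open>Recolouring \<open>i\<close> changes neither the colour nor the guess of a
    non-neighbour \<open>s\<close>. So the complement of \<open>USN i\<close> is closed under it,
    and \<open>i\<close> is still right there in one case out of \<open>q\<close>.\<close>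
  have cardAN: "q * card {c \<in> \<Omega> - USN i. g i c = c i} = card (\<Omega> - USN i)" if i: "i \<in> V - S" for i
  proof (rule card_correct_guess[of "\<Omega> - USN i" V])
    show "c(i := x) \<in> \<Omega> - USN i" if "c \<in> \<Omega> - USN i" "x \<in> {1..q}" for c x
    proof -
      have "c(i := x) \<notin> A s" if s: "s \<in> S" "{s, i} \<notin> E" for s
      proof -
        have "s \<noteq> i" using s i by auto
        have "c \<notin> A s" using \<open>c \<in> \<Omega> - USN i\<close> s by (auto simp: USN_def)
        then show ?thesis using \<open>s \<noteq> i\<close> \<open>c \<in> \<Omega> - USN i\<close> g_upd[OF s(2)] by (auto simp: A_def)
      qed
      then show ?thesis using that i upd by (auto simp: USN_def)
    qed
  qed (use i g_mem g_upd[OF noloop] in \<open>auto simp: \<Omega>_def\<close>)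
  have "\<Omega> \<subseteq> US \<union> (\<Union>i\<in>V - S. {c \<in> \<Omega> - USN i. g i c = c i})"
  proof
    fix c assume c: "c \<in> \<Omega>"
    then obtain v where v: "v \<in> V" "g v c = c v"
      using win unfolding winning_strategy_def hat_assignments_def \<Omega>_def g_def by auto
    then show "c \<in> US \<union> (\<Union>i\<in>V - S. {c \<in> \<Omega> - USN i. g i c = c i})"
      using c subsetD[OF Un_sub(1), of c v] by (cases "v \<in> S") (auto simp: US_def A_def)
  qed
  then have "card \<Omega> \<le> card (US \<union> (\<Union>i\<in>V - S. {c \<in> \<Omega> - USN i. g i c = c i}))"
    using fUS fin V by (intro card_mono) auto
  also have "\<dots> \<le> card US + card (\<Union>i\<in>V - S. {c \<in> \<Omega> - USN i. g i c = c i})" by (rule card_Un_le)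
  also have "\<dots> \<le> card US + (\<Sum>i\<in>V - S. card {c \<in> \<Omega> - USN i. g i c = c i})"
    using V by (intro add_left_mono card_UN_le) auto
  finally have "q * card \<Omega> \<le> q * (card US + (\<Sum>i\<in>V - S. card {c \<in> \<Omega> - USN i. g i c = c i}))"
    by (rule mult_left_mono) simp
  also have "\<dots> = q * card US + (\<Sum>i\<in>V - S. card (\<Omega> - USN i))"
    using cardAN by (simp add: distrib_left sum_distrib_left)
  finally have 1: "q * card \<Omega> \<le> q * card US + (\<Sum>i\<in>V - S. card (\<Omega> - USN i))" .
  \<comment> \<open>If \<open>s\<close> guesses correctly, then every non-neighbour of \<open>s\<close> outside \<open>S\<close> is superfluous.\<close>
  have "D * card US = (\<Sum>c\<in>US. D)" by simp
  also have "\<dots> \<le> (\<Sum>c\<in>US. card {i \<in> V - S. c \<in> USN i})"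
  proof (intro sum_mono)
    fix c assume "c \<in> US"
    then obtain s where s: "s \<in> S" "c \<in> A s" by (auto simp: US_def)
    have "D \<le> card {i \<in> V - S. {s, i} \<notin> E}" by (rule D[OF s(1)])
    also have "\<dots> \<le> card {i \<in> V - S. c \<in> USN i}"
      using s V by (intro card_mono) (auto simp: USN_def)
    finally show "D \<le> card {i \<in> V - S. c \<in> USN i}" .
  qed
  also have "\<dots> = (\<Sum>i\<in>V - S. card {c \<in> US. c \<in> USN i})"
    using fUS V by (intro sum_multicount_gen) auto
  also have "\<dots> = (\<Sum>i\<in>V - S. card (USN i))"
    using subsetD[OF Un_sub(1)] by (intro sum.cong refl arg_cong[of _ _ card]) auto
  finally have "D * card US + (\<Sum>i\<in>V - S. card (\<Omega> - USN i)) \<le> (\<Sum>i\<in>V - S. card (USN i) + card (\<Omega> - USN i))"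
    by (simp add: sum.distrib)
  also have "\<dots> = (\<Sum>i\<in>V - S. card \<Omega>)"
    using card_Diff_subset[OF fUN Un_sub(2)] card_mono[OF fin Un_sub(2)] by (intro sum.cong refl) simp
  also have "\<dots> = card (V - S) * card \<Omega>" by simp
  finally have 2: "D * card US + (\<Sum>i\<in>V - S. card (\<Omega> - USN i)) \<le> card (V - S) * card \<Omega>" .
  have "q * card US \<le> q * (\<Sum>s\<in>S. card (A s))"
    unfolding US_def using fS by (intro mult_left_mono card_UN_le) auto
  also have "\<dots> = card S * card \<Omega>" using cardA V by (simp add: sum_distrib_left subset_iff)
  finally have 3: "q * card US \<le> card S * card \<Omega>" .
  have "q * card \<Omega> + D * card US \<le> q * card US + card (V - S) * card \<Omega>" using 1 2 by simp
  then have 4: "q * card \<Omega> \<le> (q - D) * card US + card (V - S) * card \<Omega>"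
    using Dq by (simp add: diff_mult_distrib)
  have "q * (q * card \<Omega>) \<le> q * ((q - D) * card US + card (V - S) * card \<Omega>)"
    by (rule mult_left_mono[OF 4]) simp
  also have "\<dots> = (q - D) * (q * card US) + q * card (V - S) * card \<Omega>" by (simp add: algebra_simps)
  also have "\<dots> \<le> (q - D) * (card S * card \<Omega>) + q * card (V - S) * card \<Omega>"
    by (intro add_right_mono mult_left_mono 3) simp
  finally have "card \<Omega> * (q * q) \<le> card \<Omega> * ((q - D) * card S + q * card (V - S))"
    by (simp add: algebra_simps)
  moreover have "card \<Omega> > 0 \<or> q = 0"
    using V by (auto simp: \<Omega>_def card_PiE)
  ultimately have "q * q \<le> (q - D) * card S + q * card (V - S)" using Dq by auto
  moreover have "(q - D) * card S + D * card S = q * card S"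
    using Dq by (simp flip: add_mult_distrib)
  moreover have "q * card S + q * card (V - S) = q * card V"
    using V fS card_mono[OF V(1,3)] by (simp add: card_Diff_subset flip: distrib_left)
  ultimately show ?thesis by linarith
qed

section \<open>The hat guessing number as an attained maximum\<close>

lemma winning_strategy_le_card:
  assumes "finite V" "E \<subseteq> all_edges V" "winning_strategy V E q f"
  shows "q \<le> card V"
proof (cases "q = 0")
  case False
  \<comment> \<open>Taking \<open>S = {}\<close> leaves the plain union bound.\<close>
  have "q * q + 0 * card ({} :: 'a set) \<le> q * card V"
    by (rule winning_strategy_bound[OF assms(1,2) _ assms(3)]) auto
  then show ?thesis using False by simp
qed simp

lemma le_HG:
  assumes "finite V" "E \<subseteq> all_edges V" "winning_strategy V E q f" "0 < q"
  shows "q \<le> HG V E"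
  unfolding HG_def
  by (rule Greatest_le_nat[where b = "card V"]) (use assms winning_strategy_le_card in blast)+

lemma winning_strategy_one:
  assumes "v \<in> V"
  shows "winning_strategy V E 1 (\<lambda>_ _. 1)"
  using assms by (auto simp: winning_strategy_def guessing_strategy_def hat_assignments_def)

lemma HG_winning:
  assumes "finite V" "V \<noteq> {}" "E \<subseteq> all_edges V"
  shows "\<exists>f. winning_strategy V E (HG V E) f"
proof -
  obtain v where v: "v \<in> V" using assms by auto
  have "0 < HG V E \<and> (\<exists>f. winning_strategy V E (HG V E) f)"
    unfolding HG_def
  proof (rule GreatestI_nat[where k = 1 and b = "card V"])
    show "0 < (1::nat) \<and> (\<exists>f. winning_strategy V E 1 f)"
      using winning_strategy_one[OF v] by blast
  qed (use assms winning_strategy_le_card in blast)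
  then show ?thesis by blast
qed

section \<open>Strategies on books\<close>

text \<open>The probabilistic method by repeated averaging: double counting gives some
  \<open>g\<close> in \<open>F\<close> that leaves at most half of \<open>TT\<close> unserved, and
  every element of \<open>W\<close> halves the remainder again until nothing is left.\<close>

lemma exists_family_covering:
  fixes R :: "'g \<Rightarrow> 't \<Rightarrow> bool"
  assumes F: "finite F" "F \<noteq> {}" and "finite W" and "finite TT"
    and "\<And>T. T \<in> TT \<Longrightarrow> 2 * card {g\<in>F. \<not> R g T} \<le> card F" and "card TT < 2 ^ card W"
  shows "\<exists>G. (\<forall>w\<in>W. G w \<in> F) \<and> (\<forall>T\<in>TT. \<exists>w\<in>W. R (G w) T)"
  using assms(3-)
proof (induction W arbitrary: TT rule: finite_induct)
  case empty
  then show ?case by auto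
next
  case (insert w W)
  have "\<exists>g\<in>F. 2 * card {T\<in>TT. \<not> R g T} \<le> card TT"
  proof (rule ccontr)
    assume "\<not> ?thesis"
    then have "(\<Sum>g\<in>F. card TT) < (\<Sum>g\<in>F. 2 * card {T\<in>TT. \<not> R g T})"
      using F by (intro sum_strict_mono) auto
    also have "\<dots> = 2 * (\<Sum>g\<in>F. card {T\<in>TT. \<not> R g T})" by (simp add: sum_distrib_left)
    also have "(\<Sum>g\<in>F. card {T\<in>TT. \<not> R g T}) = (\<Sum>T\<in>TT. card {g\<in>F. \<not> R g T})"
      using F insert.prems by (intro sum_multicount_gen) auto
    also have "2 * \<dots> = (\<Sum>T\<in>TT. 2 * card {g\<in>F. \<not> R g T})" by (simp add: sum_distrib_left)
    also have "\<dots> \<le> (\<Sum>T\<in>TT. card F)" using insert.prems by (intro sum_mono) auto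
    finally show False by (simp add: mult.commute)
  qed
  then obtain g where g: "g \<in> F" "2 * card {T\<in>TT. \<not> R g T} \<le> card TT" by blast
  have "\<exists>G. (\<forall>w\<in>W. G w \<in> F) \<and> (\<forall>T\<in>{T\<in>TT. \<not> R g T}. \<exists>w\<in>W. R (G w) T)"
  proof (rule insert.IH)
    show "card {T\<in>TT. \<not> R g T} < 2 ^ card W" using g insert.prems insert.hyps by simp
  qed (use insert.prems in auto)
  then obtain G where G: "\<And>w. w \<in> W \<Longrightarrow> G w \<in> F"
    "\<And>T. T \<in> TT \<Longrightarrow> \<not> R g T \<Longrightarrow> \<exists>w\<in>W. R (G w) T" by blast
  have G': "(G(w := g)) v = G v" if "v \<in> W" for v using that insert.hyps by auto
  have "\<forall>v\<in>insert w W. (G(w := g)) v \<in> F" using G(1) G' g(1) by auto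
  moreover have "\<exists>v\<in>insert w W. R ((G(w := g)) v) T" if T: "T \<in> TT" for T
  proof (cases "R g T")
    case False
    then obtain v where "v \<in> W" "R (G v) T" using G(2)[OF T] by blast
    then show ?thesis using G'[of v] by (metis insertI2)
  qed auto
  ultimately show ?case by blast
qed

text \<open>On a set of \<open>t\<close> points a uniformly random function misses a given colour
  with probability \<open>(1 - 1/q) ^ t\<close>, hence some colour with probability at most
  \<open>q * (1 - 1/q) ^ t\<close>, which is at most 1/2 by assumption.\<close>

lemma exists_functions_onto_on_large_sets:
  fixes X :: "'x set" and W :: "'w set" and q :: nat
  assumes X: "finite X" and W: "finite W" and q: "0 < q" "2 * q * (q - 1) ^ t \<le> q ^ t"
    and few: "card X choose t < 2 ^ card W"
  shows "\<exists>G. (\<forall>w\<in>W. G w \<in> X \<rightarrow>\<^sub>E {1..q}) \<and>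
             (\<forall>T. T \<subseteq> X \<and> card T = t \<longrightarrow> (\<exists>w\<in>W. {1..q} \<subseteq> G w ` T))"
proof -
  define F where "F = X \<rightarrow>\<^sub>E {1..q}"
  have F: "finite F" "F \<noteq> {}" "card F = q ^ card X"
    using X q by (auto simp: F_def finite_PiE PiE_eq_empty_iff card_PiE)
  have "\<exists>G. (\<forall>w\<in>W. G w \<in> F) \<and> (\<forall>T\<in>{T. T \<subseteq> X \<and> card T = t}. \<exists>w\<in>W. {1..q} \<subseteq> G w ` T)"
  proof (rule exists_family_covering)
    show "card {T. T \<subseteq> X \<and> card T = t} < 2 ^ card W" using few n_subsets[OF X] by simp
    fix T assume "T \<in> {T. T \<subseteq> X \<and> card T = t}"
    then have T: "T \<subseteq> X" "card T = t" by auto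
    have fT: "finite T" using T X finite_subset by blast
    define A where "A = (\<lambda>k. (X \<rightarrow>\<^sub>E {1..q}) \<inter> {g. \<forall>x\<in>T. g x \<noteq> k})"
    have A: "card (A k) = (q - 1) ^ t * q ^ (card X - t)" if k: "k \<in> {1..q}" for k
    proof -
      have "A k = (\<Pi>\<^sub>E x\<in>X. if x \<in> T then {1..q} - {k} else {1..q})"
        using T by (auto simp: A_def PiE_iff split: if_splits)
      then have "card (A k) = (\<Prod>x\<in>X. if x \<in> T then q - 1 else q)"
        using X k by (auto simp: card_PiE intro!: prod.cong)
      also have "\<dots> = (q - 1) ^ t * q ^ (card X - t)"
        using X T fT by (simp add: prod.If_cases Int_absorb1 card_Diff_subset flip: Diff_eq)
      finally show ?thesis .
    qed
    have "card {g\<in>F. \<not> {1..q} \<subseteq> g ` T} \<le> card (\<Union>k\<in>{1..q}. A k)"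
    proof (rule card_mono)
      show "finite (\<Union>k\<in>{1..q}. A k)" using X by (simp add: A_def finite_PiE)
      show "{g\<in>F. \<not> {1..q} \<subseteq> g ` T} \<subseteq> (\<Union>k\<in>{1..q}. A k)"
        unfolding F_def A_def by blast
    qed
    also have "\<dots> \<le> (\<Sum>k\<in>{1..q}. card (A k))" by (rule card_UN_le) simp
    also have "\<dots> = q * ((q - 1) ^ t * q ^ (card X - t))" using A by simp
    finally have "2 * card {g\<in>F. \<not> {1..q} \<subseteq> g ` T} \<le> (2 * q * (q - 1) ^ t) * q ^ (card X - t)" by simp
    also have "\<dots> \<le> q ^ t * q ^ (card X - t)" by (intro mult_right_mono q(2)) simp
    also have "\<dots> = card F" using card_mono[OF X T(1)] T(2) F(3) by (simp flip: power_add)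
    finally show "2 * card {g\<in>F. \<not> {1..q} \<subseteq> g ` T} \<le> card F" .
  qed (use F W X in auto)
  then show ?thesis by (simp add: F_def)
qed

text \<open>The pages \<open>W\<close> guess by functions \<open>G w\<close> of the colours on the
  spine \<open>U\<close>. If \<open>t\<close> spine colourings made every page wrong, some
  \<open>G w\<close> would take all colours on them, including the colour of \<open>w\<close>. So
  fewer than \<open>t\<close> survive, and the clique covers these.\<close>

lemma winning_strategy_book:
  fixes V :: "'v set"
  assumes V: "finite V" "U \<subseteq> V" "U \<noteq> {}" "W \<subseteq> V - U"
    and clique: "\<And>u u'. u \<in> U \<Longrightarrow> u' \<in> U \<Longrightarrow> u \<noteq> u' \<Longrightarrow> {u, u'} \<in> E"
    and pages: "\<And>u w. u \<in> U \<Longrightarrow> w \<in> W \<Longrightarrow> {u, w} \<in> E"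
    and q: "0 < q" "2 * q * (q - 1) ^ t \<le> q ^ t"
    and few: "q ^ card U choose t < 2 ^ card W" and t: "t \<le> card U ^ card U"
  shows "\<exists>f. winning_strategy V E q f"
proof -
  define X where "X = U \<rightarrow>\<^sub>E {1..q}"
  have fU: "finite U" and fW: "finite W" using V by (auto intro: finite_subset)
  have X: "finite X" "card X = q ^ card U" using fU by (simp_all add: X_def finite_PiE card_PiE)
  obtain G where G: "\<And>w. w \<in> W \<Longrightarrow> G w \<in> X \<rightarrow>\<^sub>E {1..q}"
    "\<And>T. T \<subseteq> X \<Longrightarrow> card T = t \<Longrightarrow> \<exists>w\<in>W. {1..q} \<subseteq> G w ` T"
    using exists_functions_onto_on_large_sets[OF X(1) fW q] few X(2) by metis
  \<comment> \<open>This set depends on \<open>y\<close> only through \<open>W\<close>, which every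
    spine vertex sees. So all of \<open>U\<close> find the same survivors and, through
    \<open>SOME\<close>, agree on one \<open>h\<close>.\<close>
  define survivors where "survivors = (\<lambda>y :: 'v \<Rightarrow> nat. {x\<in>X. \<forall>w\<in>W. G w x \<noteq> y w})"
  define h where "h = (\<lambda>y. SOME h. \<forall>x\<in>survivors y. \<exists>u\<in>U. h u (restrict x (U - {u})) = x u)"
  define guess where "guess = (\<lambda>v y. if v \<in> W then G v (restrict y U) else h y v (restrict y (U - {v})))"
  \<comment> \<open>Guesses outside the palette, which \<open>h\<close> may produce, become 1; no
    right guess is lost, as all colours lie in the palette.\<close>
  define f where "f = (\<lambda>v y. if guess v y \<in> {1..q} then guess v y else 1)"
  have h: "\<exists>u\<in>U. h y u (restrict x (U - {u})) = x u"
    if y: "\<And>w. w \<in> W \<Longrightarrow> y w \<in> {1..q}" and x: "x \<in> survivors y" for x y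
  proof -
    have fin: "finite (survivors y)" using X by (simp add: survivors_def)
    have "card (survivors y) < t"
    proof (rule ccontr)
      assume "\<not> ?thesis"
      then obtain T where T: "T \<subseteq> survivors y" "card T = t" 
        by (meson obtain_subset_with_card_n not_less)
      then obtain w where w: "w \<in> W" "{1..q} \<subseteq> G w ` T" using G(2)[of T] by (auto simp: survivors_def)
      then obtain z where "z \<in> T" "G w z = y w" using y[OF w(1)] by (metis imageE subsetD)
      then show False using T(1) w(1) by (auto simp: survivors_def)
    qed
    then have "\<exists>h. \<forall>x\<in>survivors y. \<exists>u\<in>U. h u (restrict x (U - {u})) = x u"
      using t V(3) fU fin by (intro clique_covers_few_colorings[where B = "{1..q}"])
        (auto simp: survivors_def X_def)
    from someI_ex[OF this] show ?thesis using x unfolding h_def by blast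
  qed
  have "winning_strategy V E q f"
    unfolding winning_strategy_def guessing_strategy_def hat_assignments_def
  proof (intro conjI ballI)
    show "f v \<in> (nbhd V E v \<rightarrow>\<^sub>E {1..q}) \<rightarrow> {1..q}" for v using q by (simp add: f_def)
    fix c assume c: "c \<in> V \<rightarrow>\<^sub>E {1..q}"
    have fI: "f v y = c v" if "guess v y = c v" "v \<in> V" for v y
      using that c by (auto simp: f_def dest: PiE_mem)
    define x where "x = restrict c U"
    have xX: "x \<in> X" using c V by (auto simp: x_def X_def)
    show "\<exists>v\<in>V. f v (restrict c (nbhd V E v)) = c v"
    proof (cases "\<exists>w\<in>W. G w x = c w")
      case True
      then obtain w where w: "w \<in> W" "G w x = c w" by blast
      have "U \<subseteq> nbhd V E w" using pages w V by (auto simp: nbhd_def)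
      then have "restrict (restrict c (nbhd V E w)) U = x" by (simp add: x_def Int_absorb1)
      then show ?thesis using w V by (intro bexI[of _ w] fI) (auto simp: guess_def)
    next
      case False
      have sub: "W \<subseteq> nbhd V E u" "U - {u} \<subseteq> nbhd V E u" if "u \<in> U" for u
        using that pages[OF that] clique[OF _ that] V by (auto simp: nbhd_def insert_commute)
      have surv: "survivors (restrict c (nbhd V E u)) = survivors c" if "u \<in> U" for u
        using sub(1)[OF that] unfolding survivors_def by (auto simp: subset_iff)
      have "x \<in> survivors c" using False xX by (auto simp: survivors_def)
      moreover have "\<And>w. w \<in> W \<Longrightarrow> c w \<in> {1..q}" using c V by (auto dest: PiE_mem)
      ultimately obtain u where u: "u \<in> U" "h c u (restrict x (U - {u})) = x u" using h[of c x] by blast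
      have "restrict (restrict c (nbhd V E u)) (U - {u}) = restrict x (U - {u})"
        using sub(2)[OF u(1)] by (auto simp: x_def fun_eq_iff restrict_def)
      moreover have "h (restrict c (nbhd V E u)) = h c" unfolding h_def surv[OF u(1)] ..
      moreover have "u \<notin> W" using u V by auto
      ultimately have "guess u (restrict c (nbhd V E u)) = c u"
        using u by (simp add: guess_def x_def)
      then show ?thesis using u V by (intro bexI[of _ u] fI) auto
    qed
  qed
  then show ?thesis by blast
qed

section \<open>Random graphs\<close>

text \<open>Chernoff's method for the lower tail. With \<open>Y\<close> the number of blocks that
  are constantly \<open>b\<close>, \<open>(1/2) ^ Y\<close> is a product of independent factors of
  mean \<open>1 - r/2\<close>, so its expectation is at most \<open>exp (- m/2)\<close>; on the bad
  event it is at least \<open>exp (- m/4)\<close>.\<close>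

lemma prob_few_constant_blocks:
  fixes p :: real and b :: bool and d :: nat
  assumes p: "0 \<le> p" "p \<le> 1" and A: "finite A" and J: "finite J"
    and K: "\<And>j. j \<in> J \<Longrightarrow> K j \<subseteq> A" "disjoint_family_on K J" "\<And>j. j \<in> J \<Longrightarrow> card (K j) = d"
  defines "r \<equiv> (if b then p else 1 - p) ^ d"
  shows "measure_pmf.prob (Pi_pmf A False (\<lambda>_. bernoulli_pmf p))
           {\<omega>. real (card {j\<in>J. \<forall>i\<in>K j. \<omega> i = b}) \<le> r * real (card J) / 4}
         \<le> exp (- (r * real (card J) / 4))"
proof -
  define M where "M = Pi_pmf A False (\<lambda>_. bernoulli_pmf p)"
  define X where "X = (\<lambda>j (\<omega> :: 'a \<Rightarrow> bool). if \<forall>i\<in>K j. \<omega> i = b then 1 / 2 else (1::real))"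
  define Y where "Y = (\<lambda>\<omega>. card {j\<in>J. \<forall>i\<in>K j. \<omega> i = b})"
  define m where "m = r * real (card J)"
  have r: "0 \<le> r" "r \<le> 1" using p by (auto simp: r_def power_le_one)
  have m: "0 \<le> m" using r by (simp add: m_def)
  have fK: "finite (K j)" if "j \<in> J" for j using K(1)[OF that] A finite_subset by blast
  have "prob_space.indep_vars M (\<lambda>j. PiM (K j) (\<lambda>_. count_space UNIV)) (\<lambda>j \<omega>. restrict (\<lambda>i. \<omega> i) (K j)) J"
    unfolding M_def
    by (rule prob_space.indep_vars_restrict[OF measure_pmf.prob_space_axioms indep_vars_Pi_pmf[OF A] K(1,2)])
  then have "prob_space.indep_vars M (\<lambda>_. borel) (\<lambda>j \<omega>. X j (restrict (\<lambda>i. \<omega> i) (K j))) J"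
  proof (rule prob_space.indep_vars_compose2[OF measure_pmf.prob_space_axioms])
    fix j assume j: "j \<in> J"
    show "X j \<in> borel_measurable (PiM (K j) (\<lambda>_. count_space UNIV))"
      unfolding X_def using fK[OF j] by measurable
  qed
  moreover have "X j (restrict (\<lambda>i. \<omega> i) (K j)) = X j \<omega>" for j \<omega> by (simp add: X_def)
  ultimately have ind: "prob_space.indep_vars M (\<lambda>_. borel) X J" by simp
  have "finite (set_pmf M)" 
    unfolding M_def using A by (subst set_Pi_pmf) (auto intro!: finite_PiE_dflt)
  then have int: "integrable M f" for f :: "_ \<Rightarrow> real" by (rule integrable_measure_pmf_finite)
  have EX: "measure_pmf.expectation M (X j) = 1 - r / 2" if j: "j \<in> J" for j
  proof -
    \<comment> \<open>The event is written as a box over all of \<open>A\<close>, unconstrained off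
      the block, so that the product formula applies.\<close>
    let ?B = "\<lambda>i. if i \<in> K j then {b} else UNIV"
    have "measure_pmf.prob M {\<omega>. \<forall>i\<in>K j. \<omega> i = b} = measure_pmf.prob M (Pi A ?B)"
      using K(1)[OF j] by (intro arg_cong[of _ _ "measure_pmf.prob M"]) (auto simp: Pi_def)
    also have "\<dots> = (\<Prod>i\<in>A. measure_pmf.prob (bernoulli_pmf p) (?B i))"
      unfolding M_def by (rule measure_Pi_pmf_Pi[OF A])
    also have "\<dots> = (\<Prod>i\<in>A. if i \<in> K j then (if b then p else 1 - p) else 1)"
      using p by (intro prod.cong refl) (auto simp: measure_pmf_single)
    also have "\<dots> = r"
      using A K(1)[OF j] K(3)[OF j] by (simp add: r_def prod.If_cases Int_absorb1)
    finally have P: "measure_pmf.prob M {\<omega>. \<forall>i\<in>K j. \<omega> i = b} = r" .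
    have "X j = (\<lambda>\<omega>. 1 - indicator {\<omega>. \<forall>i\<in>K j. \<omega> i = b} \<omega> / 2)"
      by (auto simp: X_def fun_eq_iff)
    then have "measure_pmf.expectation M (X j)
        = measure_pmf.expectation M (\<lambda>\<omega>. 1 - indicator {\<omega>. \<forall>i\<in>K j. \<omega> i = b} \<omega> / 2)" by simp
    also have "\<dots> = 1 - measure_pmf.prob M {\<omega>. \<forall>i\<in>K j. \<omega> i = b} / 2"
      by (subst Bochner_Integration.integral_diff) (auto intro: int)
    finally show ?thesis using P by simp
  qed
  have prodX: "(\<Prod>j\<in>J. X j \<omega>) = (1 / 2) ^ Y \<omega>" for \<omega>
    unfolding X_def Y_def using J by (simp add: prod.If_cases Int_def)
  have "measure_pmf.expectation M (\<lambda>\<omega>. (1 / 2) ^ Y \<omega>) = (\<Prod>j\<in>J. measure_pmf.expectation M (X j))"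
    unfolding prodX[symmetric]
    by (rule prob_space.indep_vars_lebesgue_integral[OF measure_pmf.prob_space_axioms J ind int])
  also have "\<dots> = (1 - r / 2) ^ card J" using EX by simp
  also have "\<dots> \<le> exp (- r / 2) ^ card J"
    using r exp_ge_add_one_self[of "- r / 2"] by (intro power_mono) auto
  also have "\<dots> = exp (- m / 2)" by (simp add: m_def mult.commute flip: exp_of_nat_mult)
  finally have E: "measure_pmf.expectation M (\<lambda>\<omega>. (1 / 2) ^ Y \<omega>) \<le> exp (- m / 2)" .
  have "measure_pmf.prob M {\<omega>. real (Y \<omega>) \<le> m / 4} * exp (- m / 4)
      = measure_pmf.expectation M (\<lambda>\<omega>. indicator {\<omega>. real (Y \<omega>) \<le> m / 4} \<omega> * exp (- m / 4))"
    by simp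
  also have "\<dots> \<le> measure_pmf.expectation M (\<lambda>\<omega>. (1 / 2) ^ Y \<omega>)"
  proof (intro integral_mono int)
    fix \<omega>
    show "indicator {\<omega>. real (Y \<omega>) \<le> m / 4} \<omega> * exp (- m / 4) \<le> (1 / 2 :: real) ^ Y \<omega>"
    proof (cases "real (Y \<omega>) \<le> m / 4")
      case True
      then have "exp (- m / 4) \<le> exp (- real (Y \<omega>))" by simp
      also have "\<dots> = exp (- 1) ^ Y \<omega>" by (simp flip: exp_of_nat_mult)
      also have "\<dots> \<le> (1 / 2) ^ Y \<omega>"
        using exp_ge_add_one_self[of "1::real"] by (intro power_mono) (auto simp: exp_minus field_simps)
      finally show ?thesis using True by simp
    qed simp
  qed
  also note E
  finally have "measure_pmf.prob M {\<omega>. real (Y \<omega>) \<le> m / 4} \<le> exp (- m / 2) / exp (- m / 4)"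
    by (simp add: field_simps)
  also have "\<dots> = exp (- (m / 4))" by (simp flip: exp_diff)
  finally show ?thesis unfolding M_def Y_def m_def by simp
qed

lemma set_pmf_gnp: "E \<in> set_pmf (gnp n p) \<Longrightarrow> E \<subseteq> all_edges {1..n}"
  by (auto simp: gnp_def)

lemma finite_all_edges: "finite V \<Longrightarrow> finite (all_edges V)"
  unfolding all_edges_def by (rule finite_subset[of _ "Pow V"]) auto

text \<open>For fixed \<open>U\<close> the edge blocks joining different outside vertices to
  \<open>U\<close> are disjoint, so the tail bound for blocks applies; the factor
  \<open>n ^ d\<close> is a union bound over \<open>U\<close>. The value of \<open>b\<close> selects
  common neighbours or common non-neighbours.\<close>

lemma prob_gnp_few_common:
  fixes p :: real and b :: bool and d n :: nat
  assumes p: "0 \<le> p" "p \<le> 1"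
  defines "m \<equiv> (if b then p else 1 - p) ^ d * real (n - d) / 4"
  shows "measure_pmf.prob (gnp n p)
           {E. \<exists>U\<subseteq>{1..n}. card U = d \<and> real (card {v\<in>{1..n} - U. \<forall>u\<in>U. ({u, v} \<in> E) = b}) \<le> m}
         \<le> real n ^ d * exp (- m)"
proof -
  let ?V = "{1..n}"
  let ?M = "Pi_pmf (all_edges ?V) False (\<lambda>_. bernoulli_pmf p)"
  let ?E = "\<lambda>\<omega>. {e \<in> all_edges ?V. \<omega> e}"
  define Us where "Us = {U. U \<subseteq> ?V \<and> card U = d}"
  have fUs: "finite Us" unfolding Us_def by (rule finite_subset[of _ "Pow ?V"]) auto
  have single: "measure_pmf.prob ?M
      {\<omega>. real (card {v\<in>?V - U. \<forall>u\<in>U. ({u, v} \<in> ?E \<omega>) = b}) \<le> m} \<le> exp (- m)" if U: "U \<in> Us" for U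
  proof -
    define K where "K = (\<lambda>v. (\<lambda>u. {u, v}) ` U)"
    have U': "U \<subseteq> ?V" "card U = d" "finite U" using U by (auto simp: Us_def intro: finite_subset)
    have edge: "{u, v} \<in> all_edges ?V" if "u \<in> U" "v \<in> ?V - U" for u v
      using that U' by (auto simp: all_edges_def card_2_iff)
    have card: "card (?V - U) = n - d" using U' by (simp add: card_Diff_subset)
    have "measure_pmf.prob ?M
        {\<omega>. real (card {v\<in>?V - U. \<forall>e\<in>K v. \<omega> e = b}) \<le> (if b then p else 1 - p) ^ d * real (card (?V - U)) / 4}
      \<le> exp (- ((if b then p else 1 - p) ^ d * real (card (?V - U)) / 4))"
    proof (rule prob_few_constant_blocks[OF p])
      show "disjoint_family_on K (?V - U)"
        by (auto simp: disjoint_family_on_def K_def doubleton_eq_iff)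
      show "card (K v) = d" if "v \<in> ?V - U" for v
        using U' that by (auto simp: K_def card_image inj_on_def doubleton_eq_iff)
    qed (use edge in \<open>auto simp: K_def finite_all_edges\<close>)
    moreover have "{v\<in>?V - U. \<forall>e\<in>K v. \<omega> e = b} = {v\<in>?V - U. \<forall>u\<in>U. ({u, v} \<in> ?E \<omega>) = b}" for \<omega>
      using edge by (auto simp: K_def)
    ultimately show ?thesis unfolding m_def by (simp only: card)
  qed
  have "measure_pmf.prob (gnp n p)
           {E. \<exists>U\<subseteq>?V. card U = d \<and> real (card {v\<in>?V - U. \<forall>u\<in>U. ({u, v} \<in> E) = b}) \<le> m}
      = measure_pmf.prob ?M (\<Union>U\<in>Us. {\<omega>. real (card {v\<in>?V - U. \<forall>u\<in>U. ({u, v} \<in> ?E \<omega>) = b}) \<le> m})"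
    unfolding gnp_def measure_map_pmf Us_def by (rule arg_cong[of _ _ "measure_pmf.prob ?M"]) auto
  also have "\<dots> \<le> (\<Sum>U\<in>Us. measure_pmf.prob ?M {\<omega>. real (card {v\<in>?V - U. \<forall>u\<in>U. ({u, v} \<in> ?E \<omega>) = b}) \<le> m})"
    using fUs by (intro measure_pmf.finite_measure_subadditive_finite) auto
  also have "\<dots> \<le> (\<Sum>U\<in>Us. exp (- m))" by (intro sum_mono single)
  also have "\<dots> = real (n choose d) * exp (- m)"
    using n_subsets[of ?V d] by (simp add: Us_def)
  also have "\<dots> \<le> real n ^ d * exp (- m)"
  proof (intro mult_right_mono)
    have "n choose d \<le> n ^ d" by (cases "d \<le> n") (simp_all add: binomial_le_pow binomial_eq_0)
    then show "real (n choose d) \<le> real n ^ d" by (metis of_nat_le_iff of_nat_power)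
  qed simp
  finally show ?thesis .
qed

section \<open>From neighbourhood counts to bounds on the hat guessing number\<close>

text \<open>For any \<open>S\<close> of size \<open>k\<close>, each vertex of \<open>S\<close> has
  at least \<open>k\<close> non-neighbours outside \<open>S\<close>, so
  \<open>winning_strategy_bound\<close> with \<open>D = k\<close> gives
  \<open>q^2 + k^2 \<le> q * n\<close>.\<close>

lemma HG_le_of_nonneighbours:
  assumes V: "finite V" "V \<noteq> {}" "E \<subseteq> all_edges V"
    and nn: "\<And>v. v \<in> V \<Longrightarrow> 2 * k \<le> card {i\<in>V - {v}. {v, i} \<notin> E}"
  shows "real (HG V E) \<le> real (card V) - real k ^ 2 / real (card V)"
proof -
  define q where "q = HG V E"
  define n where "n = card V"
  obtain f where win: "winning_strategy V E q f" using HG_winning[OF V] q_def by blast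
  have qn: "q \<le> n" unfolding n_def by (rule winning_strategy_le_card[OF V(1,3) win])
  obtain v where v: "v \<in> V" using V by auto
  have "2 * k \<le> card {i\<in>V - {v}. {v, i} \<notin> E}" by (rule nn[OF v])
  also have "\<dots> \<le> n" unfolding n_def using V by (intro card_mono) auto
  finally have kn: "2 * k \<le> n" .
  have n: "n > 0" using V by (simp add: n_def card_gt_0_iff)
  show ?thesis
  proof (cases "k \<le> q")
    \<comment> \<open>Here \<open>q < k \<le> n / 2\<close>, so \<open>q \<le> n - k\<close>, which
      is stronger than the claim.\<close>
    case False
    have "real k ^ 2 / real n \<le> real k"
      using kn n by (simp add: field_simps power2_eq_square mult_left_mono)
    then show ?thesis using False kn unfolding q_def[symmetric] n_def[symmetric] by linarith
  next
    case True
    obtain S where S: "S \<subseteq> V" "card S = k"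
      using obtain_subset_with_card_n[of k V] kn n_def by auto
    have fS: "finite S" using S V finite_subset by blast
    have "q * q + k * card S \<le> q * card V"
    proof (rule winning_strategy_bound[OF V(1,3) S(1) win _ True])
      fix s assume s: "s \<in> S"
      have "2 * k \<le> card {i\<in>V - {s}. {s, i} \<notin> E}" using s S by (intro nn) auto
      also have "\<dots> \<le> card ({i\<in>V - S. {s, i} \<notin> E} \<union> S)" using V fS by (intro card_mono) auto
      also have "\<dots> \<le> card {i\<in>V - S. {s, i} \<notin> E} + k" unfolding S(2)[symmetric] by (rule card_Un_le)
      finally show "k \<le> card {i\<in>V - S. {s, i} \<notin> E}" by simp
    qed
    then have "q * q + k * k \<le> q * n" by (simp add: S n_def)
    then have le: "real q * real q + real k * real k \<le> real q * real n"
      by (metis of_nat_add of_nat_le_iff of_nat_mult)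
    have "real k * real k \<le> real q * (real n - real q)" using le by (simp add: algebra_simps)
    also have "\<dots> \<le> real n * (real n - real q)" using qn by (intro mult_right_mono) auto
    finally have "real k ^ 2 / real n \<le> real n - real q"
      using n by (simp add: field_simps power2_eq_square)
    then show ?thesis unfolding q_def[symmetric] n_def[symmetric] by linarith
  qed
qed

text \<open>Greedy growth: the current clique is padded to a set of exactly \<open>d\<close>
  vertices, and a common neighbour of that set is added to it.\<close>

lemma exists_clique_of_common_neighbours:
  assumes V: "finite V" "d \<le> card V" and "j \<le> d"
    and cn: "\<And>U. U \<subseteq> V \<Longrightarrow> card U = d \<Longrightarrow> {v\<in>V - U. \<forall>u\<in>U. {u, v} \<in> E} \<noteq> {}"
  shows "\<exists>U\<subseteq>V. card U = j \<and> (\<forall>u\<in>U. \<forall>u'\<in>U. u \<noteq> u' \<longrightarrow> {u, u'} \<in> E)"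
  using \<open>j \<le> d\<close>
proof (induction j)
  case 0
  show ?case by (intro exI[of _ "{}"]) auto
next
  case (Suc j)
  then obtain U where U: "U \<subseteq> V" "card U = j" "\<forall>u\<in>U. \<forall>u'\<in>U. u \<noteq> u' \<longrightarrow> {u, u'} \<in> E" by auto
  obtain U' where U': "U \<subseteq> U'" "U' \<subseteq> V" "card U' = d"
    using exists_subset_between[of U d V] U V Suc.prems by auto
  then obtain v where v: "v \<in> V - U'" "\<forall>u\<in>U'. {u, v} \<in> E" using cn[of U'] by auto
  have "finite U" using U V finite_subset by blast
  moreover have "v \<notin> U" using v U' by auto
  ultimately have "card (insert v U) = Suc j" using U(2) by simp
  moreover have "\<forall>u\<in>insert v U. \<forall>u'\<in>insert v U. u \<noteq> u' \<longrightarrow> {u, u'} \<in> E"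
    using U(3) v(2) U'(1) by (auto simp: insert_commute)
  ultimately show ?case using U v by (intro exI[of _ "insert v U"]) auto
qed

text \<open>A \<open>d\<close>-clique with its common neighbours as pages is a book. The bound on
  \<open>ln (2 * q)\<close> makes a random page function likely to be onto on a
  \<open>t\<close>-set, \<open>q * d ^ 2 \<le> d ^ d\<close> lets the clique cover the survivors,
  and the last hypothesis provides enough pages for all \<open>t\<close>-sets.\<close>

lemma le_HG_of_common_neighbours:
  fixes x :: real
  assumes V: "finite V" "E \<subseteq> all_edges V" and d: "0 < d" "d \<le> card V"
    and cn: "\<And>U. U \<subseteq> V \<Longrightarrow> card U = d \<Longrightarrow> x < real (card {v\<in>V - U. \<forall>u\<in>U. {u, v} \<in> E})"
    and q: "0 < q" "ln (2 * real q) \<le> real d ^ 2" "q * d ^ 2 \<le> d ^ d" "2 * real q * real d ^ 5 \<le> x"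
  shows "q \<le> HG V E"
proof -
  \<comment> \<open>With this choice
    \<open>(1 - 1/q) ^ t \<le> exp (- d^2) \<le> 1 / (2 * q)\<close>.\<close>
  define t where "t = q * d ^ 2"
  have "0 \<le> x" using q(4) by (rule order_trans[rotated]) simp
  then have "{v\<in>V - U. \<forall>u\<in>U. {u, v} \<in> E} \<noteq> {}" if "U \<subseteq> V" "card U = d" for U
    using cn[OF that] by (metis card.empty leD of_nat_0)
  from exists_clique_of_common_neighbours[OF V(1) d(2) order_refl this]
  obtain U where U: "U \<subseteq> V" "card U = d" "\<forall>u\<in>U. \<forall>u'\<in>U. u \<noteq> u' \<longrightarrow> {u, u'} \<in> E" by blast
  define W where "W = {v\<in>V - U. \<forall>u\<in>U. {u, v} \<in> E}"
  have xW: "x < real (card W)" unfolding W_def by (rule cn[OF U(1,2)])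
  have "\<exists>f. winning_strategy V E q f"
  proof (rule winning_strategy_book)
    have "real (2 * q * (q - 1) ^ t) \<le> real (q ^ t)"
    proof -
      have "real (q - 1) = real q * (1 - 1 / real q)" using q(1) by (simp add: field_simps of_nat_diff)
      also have "\<dots> \<le> real q * exp (- (1 / real q))"
        using exp_ge_add_one_self[of "- (1 / real q)"] by (intro mult_left_mono) auto
      finally have "real (q - 1) ^ t \<le> (real q * exp (- (1 / real q))) ^ t"
        by (intro power_mono) auto
      also have "\<dots> = real q ^ t * exp (- (real d ^ 2))"
        using q(1) by (simp add: power_mult_distrib t_def flip: exp_of_nat_mult)
      finally have "2 * real q * real (q - 1) ^ t \<le> 2 * real q * (real q ^ t * exp (- (real d ^ 2)))"
        by (intro mult_left_mono) auto
      also have "2 * real q \<le> exp (real d ^ 2)" using q(1,2) by (metis exp_le_cancel_iff exp_ln mult_pos_pos of_nat_0_less_iff zero_less_numeral)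
      then have "2 * real q * (real q ^ t * exp (- (real d ^ 2)))
          \<le> exp (real d ^ 2) * (real q ^ t * exp (- (real d ^ 2)))"
        by (intro mult_right_mono) auto
      also have "\<dots> = real q ^ t" by (simp add: exp_minus field_simps)
      finally show ?thesis by simp
    qed
    then show "2 * q * (q - 1) ^ t \<le> q ^ t" by (simp only: of_nat_le_iff)
    show "q ^ card U choose t < 2 ^ card W"
    proof (cases "t \<le> q ^ d")
      case True
      have q1: "ln (real q) \<le> real d ^ 2"
      proof -
        have "ln (real q) \<le> ln (2 * real q)" using q(1) by (subst ln_le_cancel_iff) auto
        then show ?thesis using q(2) by simp
      qed
      have ln2: "1 / 2 \<le> ln (2::real)" using ln2_ge_two_thirds by simp
      \<comment> \<open>There are at most \<open>q ^ (d * t)\<close> sets of \<open>t\<close>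
        colourings. In the logarithm of this bound the fifth power of \<open>d\<close> consists of
        \<open>d\<close> from the exponent, \<open>d ^ 2\<close> from \<open>t\<close> and
        \<open>d ^ 2\<close> from \<open>ln q\<close>.\<close>
      have "real (d * t) * ln (real q) \<le> real (d * t) * real d ^ 2" by (intro mult_left_mono q1) simp
      also have "\<dots> = real q * real d ^ 5" by (simp add: t_def power_numeral_reduce)
      also have "\<dots> \<le> x * (1 / 2)" using q(4) by simp
      also have "\<dots> \<le> x * ln 2" using \<open>0 \<le> x\<close> ln2 by (rule mult_left_mono[rotated])
      also have "\<dots> < real (card W) * ln 2" using xW by (intro mult_strict_right_mono) auto
      finally have "ln (real q ^ (d * t)) < ln (2 ^ card W)" using q(1) by (simp add: ln_realpow)
      then have "real q ^ (d * t) < 2 ^ card W" using q(1) by (subst (asm) ln_less_cancel_iff) auto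
      then have "real (q ^ (d * t)) < real (2 ^ card W)" by simp
      then have "q ^ (d * t) < 2 ^ card W" by (simp only: of_nat_less_iff)
      then show ?thesis using binomial_le_pow[OF True] U(2) by (simp add: power_mult)
    qed (simp add: U(2) binomial_eq_0)
  qed (use V U d q in \<open>auto simp: W_def t_def\<close>)
  then show ?thesis using le_HG[OF V _ q(1)] by blast
qed

section \<open>Clique size and asymptotics\<close>

text \<open>The factor 2 makes \<open>d ^ d\<close> equal to \<open>n ^ (2 - o(1))\<close>, well
  above \<open>n * d ^ 2\<close>, while \<open>p ^ d\<close> is still
  \<open>n ^ (- o(1))\<close>.\<close>

definition spine :: "nat \<Rightarrow> nat" where
  "spine n = nat \<lceil>2 * ln (real n) / ln (ln (real n))\<rceil>"

lemma spine_bounds: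
  assumes "0 \<le> 2 * ln (real n) / ln (ln (real n))"
  shows "2 * ln (real n) / ln (ln (real n)) \<le> real (spine n)"
    and "real (spine n) \<le> 2 * ln (real n) / ln (ln (real n)) + 1"
  using assms unfolding spine_def by linarith+

text \<open>Each estimate is first proved for the real number \<open>B = 2 ln n / ln ln n\<close>,
  by asymptotic expansion. Rounding is absorbed by \<open>B \<le> spine n \<le> B + 1\<close>, with
  the less favourable end used each time.\<close>

lemma eventually_spine:
  assumes p: "0 < p" "p < 1"
  defines "a \<equiv> - ln p"
  shows "\<forall>\<^sub>F n in at_top. 0 < spine n \<and> 2 * spine n \<le> n \<and> ln (2 * real n) \<le> real (spine n) ^ 2 \<and>
           n * spine n ^ 2 \<le> spine n ^ spine n \<and>
           real n powr (1 - ln (ln (real n)) powr (- 1 / 2)) + 1 \<le> real n * p ^ spine n / (16 * real (spine n) ^ 5) \<and>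
           real n ^ spine n * exp (- (p ^ spine n * real (n - spine n) / 4)) \<le>
             exp ((2 * ln (real n) / ln (ln (real n)) + 1) * ln (real n)
                  - real n * exp (- a * (2 * ln (real n) / ln (ln (real n)) + 1)) / 8)"
proof -
  have a: "a > 0" using p by (simp add: a_def)
  have "\<forall>\<^sub>F n in at_top. 3 \<le> 2 * ln (real n) / ln (ln (real n))" by real_asymp
  moreover have "\<forall>\<^sub>F n in at_top. 2 * ln (real n) / ln (ln (real n)) + 1 \<le> real n / 2" by real_asymp
  moreover have "\<forall>\<^sub>F n in at_top. ln (2 * real n) \<le> (2 * ln (real n) / ln (ln (real n))) ^ 2"
    by real_asymp
  \<comment> \<open>This will give \<open>n \<le> d ^ (d - 2)\<close>, that is,
    \<open>n * d ^ 2 \<le> d ^ d\<close>.\<close>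
  moreover have "\<forall>\<^sub>F n in at_top. ln (real n) \<le> (2 * ln (real n) / ln (ln (real n)) - 2) *
      ln (2 * ln (real n) / ln (ln (real n)))"
    by real_asymp
  \<comment> \<open>On the logarithmic scale the left side loses
    \<open>ln n / sqrt (ln ln n)\<close>, which exceeds the loss of order
    \<open>ln n / ln ln n\<close> on the right. The summand 1 pays for rounding \<open>q\<close>
    down, and 16 is the product of the 2 of the book bound, the 4 of the density bound and the 2
    from \<open>n - d \<ge> n / 2\<close>.\<close>
  moreover have "\<forall>\<^sub>F n in at_top. real n powr (1 - ln (ln (real n)) powr (- 1 / 2)) + 1 \<le>
      real n * exp (- a * (2 * ln (real n) / ln (ln (real n)) + 1)) / (16 * (2 * ln (real n) / ln (ln (real n)) + 1) ^ 5)"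
    using a by real_asymp
  ultimately show ?thesis using eventually_gt_at_top[of 0]
  proof eventually_elim
    case (elim n)
    define B where "B = 2 * ln (real n) / ln (ln (real n))"
    define d where "d = spine n"
    note elim = elim[folded B_def]
    have B: "B \<le> real d" "real d \<le> B + 1"
      using spine_bounds[of n] elim(1) unfolding B_def d_def by auto
    have d3: "3 \<le> real d" using B elim by linarith
    then have d3': "3 \<le> d" by linarith
    have dn: "2 * d \<le> n" using B elim by linarith
    have c1: "ln (2 * real n) \<le> real d ^ 2"
    proof -
      have "B ^ 2 \<le> real d ^ 2" using B elim(1) by (intro power_mono) auto
      then show ?thesis using elim by linarith
    qed
    have c2: "n * d ^ 2 \<le> d ^ d"
    proof -
      have "ln (real n) \<le> (B - 2) * ln B" by (rule elim)
      also have "\<dots> \<le> (real d - 2) * ln (real d)" using B elim(1) by (intro mult_mono) auto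
      also have "\<dots> = ln (real d ^ (d - 2))" using d3' by (simp add: ln_realpow of_nat_diff)
      finally have "real n \<le> real d ^ (d - 2)" using elim d3 by (subst (asm) ln_le_cancel_iff) auto
      then have "real n \<le> real (d ^ (d - 2))" by simp
      then have "n \<le> d ^ (d - 2)" by (simp only: of_nat_le_iff)
      then have "n * d ^ 2 \<le> d ^ (d - 2) * d ^ 2" by (rule mult_right_mono) simp
      also have "\<dots> = d ^ (d - 2 + 2)" by (rule power_add[symmetric])
      also have "d - 2 + 2 = d" using d3' by simp
      finally show ?thesis .
    qed
    have pd: "exp (- a * (B + 1)) \<le> p ^ d"
    proof -
      have "a * real d \<le> a * (B + 1)" using a B by (intro mult_left_mono) auto
      then have "exp (- a * (B + 1)) \<le> exp (real d * ln p)" by (simp add: a_def algebra_simps)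
      also have "\<dots> = p ^ d" using p by (simp add: exp_of_nat_mult)
      finally show ?thesis .
    qed
    have c3: "real n powr (1 - ln (ln (real n)) powr (- 1 / 2)) + 1 \<le> real n * p ^ d / (16 * real d ^ 5)"
    proof -
      have "real n * exp (- a * (B + 1)) / (16 * (B + 1) ^ 5) \<le> real n * p ^ d / (16 * real d ^ 5)"
        using pd B d3 p by (intro frac_le mult_left_mono power_mono mult_nonneg_nonneg) auto
      then show ?thesis using elim by linarith
    qed
    have c4: "real n ^ d * exp (- (p ^ d * real (n - d) / 4)) \<le>
        exp ((B + 1) * ln (real n) - real n * exp (- a * (B + 1)) / 8)"
    proof -
      have "real n ^ d = exp (real d * ln (real n))" using elim by (simp add: exp_of_nat_mult)
      moreover have "real d * ln (real n) \<le> (B + 1) * ln (real n)"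
        using B elim by (intro mult_right_mono) auto
      moreover have "real n * exp (- a * (B + 1)) / 8 \<le> p ^ d * real (n - d) / 4"
      proof -
        have "exp (- a * (B + 1)) * (real n / 8) \<le> p ^ d * (real (n - d) / 4)"
          using pd dn p by (intro mult_mono) (auto simp: of_nat_diff)
        then show ?thesis by (simp add: mult.commute)
      qed
      ultimately show ?thesis by (simp flip: exp_add)
    qed
    show ?case using d3' dn c1 c2 c3 c4 unfolding d_def B_def by simp
  qed
qed

theorem theorem1:
  fixes p :: real
  assumes "0 < p" and "p < 1"
  shows "\<exists>\<epsilon> :: nat \<Rightarrow> real.
           (\<forall>n. 0 \<le> \<epsilon> n) \<and> \<epsilon> \<longlonglongrightarrow> 0 \<and>
           (\<lambda>n. measure_pmf.prob (gnp n p)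
                  {E. real n powr (1 - \<epsilon> n) \<le> real (HG {1..n} E) \<and>
                      real (HG {1..n} E) \<le> (1 - \<epsilon> n) * real n}) \<longlonglongrightarrow> 1"
proof (intro exI conjI allI)
  note p = assms
  let ?\<epsilon> = "\<lambda>n. ln (ln (real n)) powr (- 1 / 2)"
  let ?T = "\<lambda>n. {E. real n powr (1 - ?\<epsilon> n) \<le> real (HG {1..n} E) \<and>
                      real (HG {1..n} E) \<le> (1 - ?\<epsilon> n) * real n}"
  \<comment> \<open>A value of \<open>powr\<close> is never negative, so this holds also for small
    \<open>n\<close>, where \<open>ln (ln n)\<close> need not be positive.\<close>
  show "0 \<le> ?\<epsilon> n" for n by simp
  show "?\<epsilon> \<longlonglongrightarrow> 0" by real_asymp
  \<comment> \<open>The lower bound uses \<open>b = True\<close> with \<open>d = spine n\<close>,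
    the upper bound \<open>b = False\<close> with single vertices; \<open>\<delta>1\<close> and
    \<open>\<delta>2\<close> bound the respective failure probabilities.\<close>
  define fails where "fails = (\<lambda>(b::bool) n d. {E :: nat set set. \<exists>U\<subseteq>{1..n}. card U = d \<and>
      real (card {v\<in>{1..n} - U. \<forall>u\<in>U. ({u, v} \<in> E) = b}) \<le> (if b then p else 1 - p) ^ d * real (n - d) / 4})"
  define \<delta>1 where "\<delta>1 = (\<lambda>n. exp ((2 * ln (real n) / ln (ln (real n)) + 1) * ln (real n)
      - real n * exp (- (- ln p) * (2 * ln (real n) / ln (ln (real n)) + 1)) / 8))"
  define \<delta>2 where "\<delta>2 = (\<lambda>n. real n * exp (- ((1 - p) * real (n - 1) / 4)))"
  have "\<delta>1 \<longlonglongrightarrow> 0"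
  proof -
    have "(\<lambda>n. exp ((2 * ln (real n) / ln (ln (real n)) + 1) * ln (real n)
      - real n * exp (- a * (2 * ln (real n) / ln (ln (real n)) + 1)) / 8)) \<longlonglongrightarrow> 0" if "a > 0" for a
      using that by real_asymp
    from this[of "- ln p"] show ?thesis using p by (simp add: \<delta>1_def)
  qed
  moreover have "\<delta>2 \<longlonglongrightarrow> 0"
  proof -
    have "(\<lambda>n. real n * exp (- (a * real (n - 1) / 4))) \<longlonglongrightarrow> 0" if "a > 0" for a
      using that by real_asymp
    from this[of "1 - p"] show ?thesis using p by (simp add: \<delta>2_def)
  qed
  ultimately have lim: "(\<lambda>n. 1 - \<delta>1 n - \<delta>2 n) \<longlonglongrightarrow> 1"
    using tendsto_diff[OF tendsto_diff[OF tendsto_const[of 1]]] by fastforce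
  \<comment> \<open>The upper bound saves \<open>k^2 / n\<close> with \<open>k\<close> linear in
    \<open>n\<close>, which dominates \<open>\<epsilon> n * n\<close>.\<close>
  have ev: "\<forall>\<^sub>F n in at_top. 1 \<le> (1 - p) * (real n - 1) / 8 \<and>
      ?\<epsilon> n * real n \<le> ((1 - p) * (real n - 1) / 8 - 1) ^ 2 / real n"
  proof -
    have "\<forall>\<^sub>F n in at_top. 1 \<le> a * (real n - 1) / 8" if "a > 0" for a
      using that by real_asymp
    moreover have "\<forall>\<^sub>F n in at_top. ?\<epsilon> n * real n \<le> (a * (real n - 1) / 8 - 1) ^ 2 / real n"
      if "a > 0" for a
      using that by real_asymp
    ultimately show ?thesis using p by (intro eventually_conj) auto
  qed
  show "(\<lambda>n. measure_pmf.prob (gnp n p) (?T n)) \<longlonglongrightarrow> 1"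
  proof (rule tendsto_sandwich[OF _ _ lim tendsto_const[of 1]])
    show "\<forall>\<^sub>F n in at_top. measure_pmf.prob (gnp n p) (?T n) \<le> 1" by simp
    show "\<forall>\<^sub>F n in at_top. 1 - \<delta>1 n - \<delta>2 n \<le> measure_pmf.prob (gnp n p) (?T n)"
      using eventually_spine[OF p] ev eventually_gt_at_top[of 0]
    proof eventually_elim
      case (elim n)
      define d where "d = spine n"
      have d: "0 < d" "2 * d \<le> n" "ln (2 * real n) \<le> real d ^ 2" "n * d ^ 2 \<le> d ^ d"
        "real n powr (1 - ?\<epsilon> n) + 1 \<le> real n * p ^ d / (16 * real d ^ 5)"
        "real n ^ d * exp (- (p ^ d * real (n - d) / 4)) \<le> \<delta>1 n"
        using elim(1) unfolding d_def \<delta>1_def by auto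
      have n: "0 < n" by (rule elim)
      have good: "E \<in> ?T n" if E: "E \<in> set_pmf (gnp n p)" "E \<notin> fails True n d" "E \<notin> fails False n 1" for E
      proof -
        have sub: "E \<subseteq> all_edges {1..n}" by (rule set_pmf_gnp[OF E(1)])
        define x where "x = real n * p ^ d / (16 * real d ^ 5)"
        define q where "q = nat \<lfloor>x\<rfloor>"
        \<comment> \<open>The number of non-neighbours of a vertex exceeds
          \<open>(1 - p) * (n - 1) / 4\<close>, hence \<open>2 * k\<close>.\<close>
        define k where "k = nat \<lfloor>(1 - p) * (real n - 1) / 8\<rfloor>"
        have "0 < real n powr (1 - ?\<epsilon> n)" using n by simp
        then have x1: "1 < x" using d(5) unfolding x_def[symmetric] by linarith
        have q: "x - 1 \<le> real q" "real q \<le> x" "0 < q" using x1 unfolding q_def by linarith+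
        have "q \<le> HG {1..n} E"
        proof (rule le_HG_of_common_neighbours[where d = d and x = "p ^ d * real (n - d) / 4"])
          show "p ^ d * real (n - d) / 4 < real (card {v\<in>{1..n} - U. \<forall>u\<in>U. {u, v} \<in> E})"
            if "U \<subseteq> {1..n}" "card U = d" for U
            using E(2) that unfolding fails_def by (auto simp: not_le)
          have "x \<le> real n"
          proof -
            have "real n * p ^ d \<le> real n * 1" using p by (intro mult_left_mono power_le_one) auto
            moreover have "1 \<le> 16 * real d ^ 5" using d(1) one_le_power[of "real d" 5] by linarith
            ultimately show ?thesis unfolding x_def
              using frac_le[of "real n" "real n * p ^ d" 1 "16 * real d ^ 5"] by simp
          qed
          then have qn: "q \<le> n" using q by linarith
          then have "ln (2 * real q) \<le> ln (2 * real n)" using q n by (subst ln_le_cancel_iff) auto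
          then show "ln (2 * real q) \<le> real d ^ 2" using d(3) by linarith
          show "q * d ^ 2 \<le> d ^ d" using qn d(4) by (meson le_trans mult_le_mono1)
          have "2 * real q * real d ^ 5 \<le> 2 * x * real d ^ 5" using q by (intro mult_right_mono) auto
          also have "\<dots> = p ^ d * (real n / 8)" using d(1) by (simp add: x_def field_simps)
          also have "\<dots> \<le> p ^ d * (real (n - d) / 4)"
            using d(2) p by (intro mult_left_mono) (auto simp: of_nat_diff)
          finally show "2 * real q * real d ^ 5 \<le> p ^ d * real (n - d) / 4" by simp
        qed (use sub d q in auto)
        then have lower: "real n powr (1 - ?\<epsilon> n) \<le> real (HG {1..n} E)"
          using d(5) q unfolding x_def by linarith
        have k: "(1 - p) * (real n - 1) / 8 - 1 \<le> real k" "real k \<le> (1 - p) * (real n - 1) / 8"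
          using elim(2) unfolding k_def by linarith+
        have "real (HG {1..n} E) \<le> real (card {1..n}) - real k ^ 2 / real (card {1..n})"
        proof (rule HG_le_of_nonneighbours)
          fix v assume v: "v \<in> {1..n}"
          have "(1 - p) * real (n - 1) / 4 < real (card {i\<in>{1..n} - {v}. {v, i} \<notin> E})"
            using E(3) v unfolding fails_def by (auto simp: not_le dest!: spec[of _ "{v}"])
          then have "2 * real k < real (card {i\<in>{1..n} - {v}. {v, i} \<notin> E})"
            using k n by (simp add: of_nat_diff)
          then show "2 * k \<le> card {i\<in>{1..n} - {v}. {v, i} \<notin> E}" by linarith
        qed (use sub n in auto)
        also have "\<dots> \<le> real n - ((1 - p) * (real n - 1) / 8 - 1) ^ 2 / real n"
          using k elim(2) by (auto intro!: divide_right_mono power_mono)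
        also have "\<dots> \<le> (1 - ?\<epsilon> n) * real n" using elim(2) by (simp add: algebra_simps)
        finally show ?thesis using lower by simp
      qed
      have P1: "measure_pmf.prob (gnp n p) (fails True n d) \<le> \<delta>1 n"
        using prob_gnp_few_common[where p = p and b = True and d = d and n = n] p d(6) unfolding fails_def by simp
      have P2: "measure_pmf.prob (gnp n p) (fails False n 1) \<le> \<delta>2 n"
        using prob_gnp_few_common[where p = p and b = False and d = 1 and n = n] p unfolding fails_def \<delta>2_def by simp
      have "1 - measure_pmf.prob (gnp n p) (fails True n d \<union> fails False n 1)
          = measure_pmf.prob (gnp n p) (- (fails True n d \<union> fails False n 1))"
        using measure_pmf.prob_compl[of "fails True n d \<union> fails False n 1" "gnp n p"]
        by (simp add: Compl_eq_Diff_UNIV)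
      \<comment> \<open>Only edge sets in the support are known to be subsets of
        \<open>all_edges {1..n}\<close>, which both bounds on \<open>HG\<close> require.\<close>
      also have "\<dots> = measure_pmf.prob (gnp n p) (- (fails True n d \<union> fails False n 1) \<inter> set_pmf (gnp n p))"
        by (simp add: measure_Int_set_pmf)
      also have "\<dots> \<le> measure_pmf.prob (gnp n p) (?T n)"
        by (rule measure_pmf.finite_measure_mono) (use good in auto)
      finally show ?case
        using P1 P2 measure_Un_le[of "fails True n d" "gnp n p" "fails False n 1"]
        by simp
    qed
  qed
qed

end
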